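(* Let $\underline{E}$ be the natural extension of a p-box $(\underline{F},\overline{F})$ on $(\Omega,\preceq)$, with conjugate $\overline{E}$. Let $B$ be a clopen subset of $\Omega$ (in the partition topology). Let $(B_\lambda)_{\lambda\in\Lambda}$ be the full components of $B$, and let $(C_\lambda)_{\lambda\in\Lambda'}$ be the full components of $B^c$. Then $$\underline{E}(B)=\sum_{\lambda\in\Lambda}\underline{E}(B_\lambda),\qquad \overline{E}(B)=1-\sum_{\lambda\in\Lambda'}\underline{E}(C_\lambda).$$
   Context: $(\Omega,\preceq)$ is a totally preordered set ($\preceq$ reflexive, transitive, any two elements comparable; antisymmetry not required) with a smallest element $0_\Omega$ and a largest element $1_\Omega$. Write $x\prec y$ if $x\preceq y$ and not $y\preceq x$, and $x\simeq y$ if $x\preceq y$ and $y\preceq x$; $[x]_\simeq$ is the $\simeq$-equivalence class of $x$. Intervals: $[x,y]=\{z:x\preceq z\preceq y\}$, $(x,y]=\{z:x\prec z\preceq y\}$, etc. A gamble is a bounded function $\Omega\to\mathbb{R}$; an event is identified with its indicator. A lower prevision on all gambles is coherent if $\underline{P}(f)\ge\inf f$, $\underline{P}(\lambda f)=\lambda\underline{P}(f)$, $\underline{P}(f+g)\ge\underline{P}(f)+\underline{P}(g)$ for all gambles $f,g$ and $\lambda\ge0$. A linear prevision is a functional $Q$ on all gambles with $Q(f)\ge\inf f$ and $Q(f+g)=Q(f)+Q(g)$. A cumulative distribution function is a map $F:\Omega\to[0,1]$, non-decreasing with respect to $\preceq$, with $F(1_\Omega)=1$. A p-box is a pair $(\underline{F},\overline{F})$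 of cumulative distribution functions with $\underline{F}\le\overline{F}$. Its natural extension $\underline{E}$ is the pointwise smallest coherent lower prevision on all gambles with $\underline{E}([0_\Omega,x])=\underline{F}(x)$ and $\underline{E}((y,1_\Omega])=1-\overline{F}(y)$ for all $x,y\in\Omega$; equivalently $\underline{E}(f)=\min Q(f)$ over all linear previsions $Q$ with $\underline{F}(x)\le Q([0_\Omega,x])\le\overline{F}(x)$ for all $x\in\Omega$. The conjugate is $\overline{E}(f)=-\underline{E}(-f)$, so $\overline{E}(A)=1-\underline{E}(A^c)$ for events. The partition topology on $\Omega$ is generated by the equivalence classes $[x]_\simeq$; its open sets are the unions of equivalence classes, and every open set is clopen. A set $S\subseteq\Omega$ is full if $[a,b]\subseteq S$ for any $a\preceq b$ in $S$. For a clopen set $A$ and $x\in A$, the full component of $x$ in $A$ is the largest full set $S$ with $x\in S\subseteq A$; the (distinct) full components of a clopen set $A$ form a partition of $A$. The sum of a possibly infinite family of non-negative reals is the supremum of its finite partial sums. *)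

theory Defs
  imports "HOL-Analysis.Analysis"
begin

section \<open>Bounded total preorders\<close>

text \<open>The possibility space is a type, preordered by an explicit relation \<open>le\<close>, with a smallest
  element \<open>lo\<close> and a largest element \<open>hi\<close>. Since \<open>le\<close> need not be antisymmetric, these are only
  unique up to equivalence.\<close>

definition bounded_total_preorder :: "('a \<Rightarrow> 'a \<Rightarrow> bool) \<Rightarrow> 'a \<Rightarrow> 'a \<Rightarrow> bool" where
  "bounded_total_preorder le lo hi \<longleftrightarrow>
     reflp le \<and> transp le \<and> totalp le \<and> (\<forall>x. le lo x) \<and> (\<forall>x. le x hi)"

definition strict :: "('a \<Rightarrow> 'a \<Rightarrow> bool) \<Rightarrow> 'a \<Rightarrow> 'a \<Rightarrow> bool" where
  "strict le x y \<longleftrightarrow> le x y \<and> \<not> le y x"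

definition indiff :: "('a \<Rightarrow> 'a \<Rightarrow> bool) \<Rightarrow> 'a \<Rightarrow> 'a \<Rightarrow> bool" where
  "indiff le x y \<longleftrightarrow> le x y \<and> le y x"

definition closed_interval :: "('a \<Rightarrow> 'a \<Rightarrow> bool) \<Rightarrow> 'a \<Rightarrow> 'a \<Rightarrow> 'a set" where
  "closed_interval le x y = {z. le x z \<and> le z y}"

definition left_open_interval :: "('a \<Rightarrow> 'a \<Rightarrow> bool) \<Rightarrow> 'a \<Rightarrow> 'a \<Rightarrow> 'a set" where
  "left_open_interval le x y = {z. strict le x z \<and> le z y}"

section \<open>The partition topology and full components\<close>

definition partition_topology :: "('a \<Rightarrow> 'a \<Rightarrow> bool) \<Rightarrow> 'a topology" where
  "partition_topology le = topology_generated_by (range (\<lambda>x. {y. indiff le x y}))"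

definition clopen_in :: "'a topology \<Rightarrow> 'a set \<Rightarrow> bool" where
  "clopen_in T S \<longleftrightarrow> openin T S \<and> closedin T S"

definition full :: "('a \<Rightarrow> 'a \<Rightarrow> bool) \<Rightarrow> 'a set \<Rightarrow> bool" where
  "full le S \<longleftrightarrow> (\<forall>a\<in>S. \<forall>b\<in>S. le a b \<longrightarrow> closed_interval le a b \<subseteq> S)"

definition full_component :: "('a \<Rightarrow> 'a \<Rightarrow> bool) \<Rightarrow> 'a set \<Rightarrow> 'a \<Rightarrow> 'a set" where
  "full_component le A x = (GREATEST S. full le S \<and> x \<in> S \<and> S \<subseteq> A)"

definition full_components :: "('a \<Rightarrow> 'a \<Rightarrow> bool) \<Rightarrow> 'a set \<Rightarrow> 'a set set" where
  "full_components le A = full_component le A ` A"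

section \<open>Coherent lower previsions\<close>

definition gamble :: "('a \<Rightarrow> real) \<Rightarrow> bool" where
  "gamble f \<longleftrightarrow> bounded (range f)"

text \<open>A lower prevision on all gambles is represented by a functional on all real functions whose
  values outside the gambles are irrelevant.\<close>

definition coherent :: "(('a \<Rightarrow> real) \<Rightarrow> real) \<Rightarrow> bool" where
  "coherent P \<longleftrightarrow>
     (\<forall>f. gamble f \<longrightarrow> (INF x. f x) \<le> P f) \<and>
     (\<forall>f c. gamble f \<longrightarrow> 0 \<le> c \<longrightarrow> P (\<lambda>x. c * f x) = c * P f) \<and>
     (\<forall>f g. gamble f \<longrightarrow> gamble g \<longrightarrow> P f + P g \<le> P (\<lambda>x. f x + g x))"

definition conjugate :: "(('a \<Rightarrow> real) \<Rightarrow> real) \<Rightarrow> ('a \<Rightarrow> real) \<Rightarrow> real" where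
  "conjugate P f = - P (\<lambda>x. - f x)"

section \<open>P-boxes and their natural extension\<close>

definition cdf :: "('a \<Rightarrow> 'a \<Rightarrow> bool) \<Rightarrow> 'a \<Rightarrow> ('a \<Rightarrow> real) \<Rightarrow> bool" where
  "cdf le hi F \<longleftrightarrow> range F \<subseteq> {0..1} \<and> monotone le (\<le>) F \<and> F hi = 1"

definition pbox :: "('a \<Rightarrow> 'a \<Rightarrow> bool) \<Rightarrow> 'a \<Rightarrow> ('a \<Rightarrow> real) \<Rightarrow> ('a \<Rightarrow> real) \<Rightarrow> bool" where
  "pbox le hi Fl Fu \<longleftrightarrow> cdf le hi Fl \<and> cdf le hi Fu \<and> (\<forall>x. Fl x \<le> Fu x)"

definition agrees_with_pbox ::
    "('a \<Rightarrow> 'a \<Rightarrow> bool) \<Rightarrow> 'a \<Rightarrow> 'a \<Rightarrow> ('a \<Rightarrow> real) \<Rightarrow> ('a \<Rightarrow> real) \<Rightarrow> (('a \<Rightarrow> real) \<Rightarrow> real) \<Rightarrow> bool" where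
  "agrees_with_pbox le lo hi Fl Fu P \<longleftrightarrow>
     (\<forall>x. P (indicator (closed_interval le lo x)) = Fl x) \<and>
     (\<forall>y. P (indicator (left_open_interval le y hi)) = 1 - Fu y)"

definition natural_extension ::
    "('a \<Rightarrow> 'a \<Rightarrow> bool) \<Rightarrow> 'a \<Rightarrow> 'a \<Rightarrow> ('a \<Rightarrow> real) \<Rightarrow> ('a \<Rightarrow> real) \<Rightarrow> (('a \<Rightarrow> real) \<Rightarrow> real) \<Rightarrow> bool" where
  "natural_extension le lo hi Fl Fu E \<longleftrightarrow>
     coherent E \<and> agrees_with_pbox le lo hi Fl Fu E \<and>
     (\<forall>P. coherent P \<longrightarrow> agrees_with_pbox le lo hi Fl Fu P \<longrightarrow> (\<forall>f. gamble f \<longrightarrow> E f \<le> P f))"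

section \<open>The definitions are meaningful\<close>

subsection \<open>Full components exist\<close>

lemma bounded_total_preorderD:
  assumes "bounded_total_preorder le lo hi"
  shows "le a a" and "le a b \<Longrightarrow> le b c \<Longrightarrow> le a c" and "le a b \<or> le b a"
    and "le lo a" and "le a hi"
proof -
  have r: "reflp le" and t: "transp le" "totalp le" "le lo a" "le a hi"
    using assms by (auto simp: bounded_total_preorder_def)
  show "le a a" by (rule reflpD[OF r])
  show "le a b \<Longrightarrow> le b c \<Longrightarrow> le a c" by (rule transpD[OF t(1)])
  show "le a b \<or> le b a" using reflpD[OF r, of a] totalpD[OF t(2), of a b] by (cases "a = b") auto
  show "le lo a" "le a hi" by fact+
qed

lemma openin_partition_topology_iff:
  assumes "bounded_total_preorder le lo hi"
  shows "openin (partition_topology le) A \<longleftrightarrow> (\<forall>x\<in>A. {y. indiff le x y} \<subseteq> A)"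
proof
  have refl: "indiff le a a" and trans: "indiff le a b \<Longrightarrow> indiff le b c \<Longrightarrow> indiff le a c" for a b c
    unfolding indiff_def using bounded_total_preorderD(1,2)[OF assms] by blast+
  assume "openin (partition_topology le) A"
  then have "generate_topology_on (range (\<lambda>x. {y. indiff le x y})) A"
    unfolding partition_topology_def by (simp add: openin_topology_generated_by_iff)
  then show "\<forall>x\<in>A. {y. indiff le x y} \<subseteq> A"
    by induction (use trans in blast)+
next
  have refl: "indiff le a a" for a
    unfolding indiff_def using bounded_total_preorderD(1)[OF assms] by blast
  assume "\<forall>x\<in>A. {y. indiff le x y} \<subseteq> A"
  then have "A = \<Union>((\<lambda>x. {y. indiff le x y}) ` A)" using refl by blast
  moreover have "openin (partition_topology le) \<dots>"
    unfolding partition_topology_def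
    by (intro openin_Union) (auto intro: topology_generated_by_Basis)
  ultimately show "openin (partition_topology le) A" by simp
qed

lemma full_component_greatest:
  assumes "bounded_total_preorder le lo hi" 
    and A: "openin (partition_topology le) A" "x \<in> A"
  defines "C \<equiv> full_component le A x"
  shows "full le C" and "x \<in> C" and "C \<subseteq> A"
    and "\<And>S. full le S \<Longrightarrow> x \<in> S \<Longrightarrow> S \<subseteq> A \<Longrightarrow> S \<subseteq> C"
proof -
  have refl: "le a a" and trans: "le a b \<Longrightarrow> le b c \<Longrightarrow> le a c" and tot: "le a b \<or> le b a" for a b c
    by (fact bounded_total_preorderD[OF assms(1)])+
  let ?P = "\<lambda>S. full le S \<and> x \<in> S \<and> S \<subseteq> A"
  let ?U = "\<Union>{S. ?P S}"
  have "?P {y. indiff le x y}"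
    using A refl trans unfolding openin_partition_topology_iff[OF assms(1)]
      full_def closed_interval_def indiff_def by blast
  moreover have "full le ?U"
    unfolding full_def[of le ?U]
  proof (intro ballI impI subsetI)
    fix a b c assume "a \<in> ?U" "b \<in> ?U" "le a b" "c \<in> closed_interval le a b"
    then obtain S T where ST: "?P S" "?P T" "a \<in> S" "b \<in> T" "le a c" "le c b"
      by (auto simp: closed_interval_def)
    from tot[of c x] show "c \<in> ?U"
    proof
      assume "le c x"
      moreover then have "le a x" using ST trans by blast
      ultimately have "c \<in> S" using ST unfolding full_def closed_interval_def by blast
      then show ?thesis using ST by blast
    next
      assume "le x c"
      moreover then have "le x b" using ST trans by blast
      ultimately have "c \<in> T" using ST unfolding full_def closed_interval_def by blast
      then show ?thesis using ST by blast
    qed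
  qed
  ultimately have U: "?P ?U" by blast
  have "C = ?U"
    unfolding C_def full_component_def by (rule Greatest_equality) (use U in blast)+
  then show "full le C" "x \<in> C" "C \<subseteq> A"
    "\<And>S. full le S \<Longrightarrow> x \<in> S \<Longrightarrow> S \<subseteq> A \<Longrightarrow> S \<subseteq> C"
    using U by auto
qed

subsection \<open>The natural extension exists\<close>

lemma gamble_indicator: "gamble (indicator S)"
  unfolding gamble_def by (rule boundedI[of _ 1]) (auto simp: indicator_def)

lemma gambleE:
  assumes "gamble f" obtains K where "\<And>x. \<bar>f x\<bar> \<le> K"
  using assms unfolding gamble_def bounded_iff by auto

lemma gamble_bdd: assumes "gamble f" shows "bdd_below (range f)" "bdd_above (range f)"
  using assms bounded_imp_bdd_below bounded_imp_bdd_above unfolding gamble_def by auto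

lemma coherent_INF:
  assumes "M \<noteq> {}" and M: "\<And>P. P \<in> M \<Longrightarrow> coherent P"
  shows "coherent (\<lambda>f. INF P\<in>M. P f)"
proof -
  have bdd: "bdd_below ((\<lambda>P. P f) ` M)" if "gamble f" for f
    using M that unfolding coherent_def by (intro bdd_belowI2[of _ "INF x. f x"]) auto
  show ?thesis
    unfolding coherent_def
  proof (intro conjI allI impI)
    fix f :: "'a \<Rightarrow> real" assume f: "gamble f"
    show "(INF x. f x) \<le> (INF P\<in>M. P f)"
      using assms f by (intro cINF_greatest) (auto simp: coherent_def)
    fix c :: real assume "0 \<le> c"
    have "(INF P\<in>M. P (\<lambda>x. c * f x)) = (INF P\<in>M. c * P f)"
      using M f \<open>0 \<le> c\<close> by (intro INF_cong) (auto simp: coherent_def)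
    also have "\<dots> = c * (INF P\<in>M. P f)"
    proof (cases "c = 0")
      case False
      then have "c > 0" using \<open>0 \<le> c\<close> by simp
      show ?thesis
      proof (rule antisym)
        have "(INF P\<in>M. c * P f) / c \<le> (INF P\<in>M. P f)"
        proof (rule cINF_greatest[OF assms(1)])
          fix P assume "P \<in> M"
          obtain l where l: "\<And>P. P \<in> M \<Longrightarrow> l \<le> P f" using bdd[OF f] by (auto simp: bdd_below_def)
          have "bdd_below ((\<lambda>P. c * P f) ` M)"
            using l \<open>c > 0\<close> by (intro bdd_belowI2[of _ "c * l"]) auto
          then have "(INF P\<in>M. c * P f) \<le> c * P f" using \<open>P \<in> M\<close> by (rule cINF_lower)
          then show "(INF P\<in>M. c * P f) / c \<le> P f" using \<open>c > 0\<close> by (simp add: field_simps)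
        qed
        then show "(INF P\<in>M. c * P f) \<le> c * (INF P\<in>M. P f)"
          using \<open>c > 0\<close> by (simp add: field_simps)
        show "c * (INF P\<in>M. P f) \<le> (INF P\<in>M. c * P f)"
          using \<open>c > 0\<close> bdd[OF f] by (intro cINF_greatest[OF assms(1)] mult_left_mono cINF_lower) auto
      qed
    qed (use assms(1) in simp)
    finally show "(INF P\<in>M. P (\<lambda>x. c * f x)) = c * (INF P\<in>M. P f)" .
  next
    fix f g :: "'a \<Rightarrow> real" assume f: "gamble f" and g: "gamble g"
    show "(INF P\<in>M. P f) + (INF P\<in>M. P g) \<le> (INF P\<in>M. P (\<lambda>x. f x + g x))"
    proof (rule cINF_greatest[OF assms(1)])
      fix P assume P: "P \<in> M"
      have "(INF P\<in>M. P f) + (INF P\<in>M. P g) \<le> P f + P g"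
        using bdd f g P by (intro add_mono cINF_lower) auto
      also have "\<dots> \<le> P (\<lambda>x. f x + g x)" using M[OF P] f g by (auto simp: coherent_def)
      finally show "(INF P\<in>M. P f) + (INF P\<in>M. P g) \<le> P (\<lambda>x. f x + g x)" .
    qed
  qed
qed

lemma cdf_coherent_exists:
  assumes "bounded_total_preorder le lo hi" and F: "cdf le hi F"
  shows "\<exists>Q. coherent Q \<and> agrees_with_pbox le lo hi F F Q"
proof -
  have trans: "\<And>a b c. le a b \<Longrightarrow> le b c \<Longrightarrow> le a c" and tot: "\<And>a b. le a b \<or> le b a"
    and lo: "\<And>a. le lo a" and hi: "\<And>a. le a hi"
    by (fact bounded_total_preorderD[OF assms(1)])+
  have F01: "\<And>x. 0 \<le> F x" "\<And>x. F x \<le> 1" "F hi = 1" and Fm: "\<And>x y. le x y \<Longrightarrow> F x \<le> F y"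
    using F unfolding cdf_def by (auto simp: monotone_def image_subset_iff)
  define C :: "('a \<Rightarrow> real) \<Rightarrow> (real \<Rightarrow> real) \<Rightarrow> bool" where
    "C f s \<longleftrightarrow> s integrable_on {0..1} \<and>
       (\<forall>u\<in>{0..1}. \<exists>y. u \<le> F y \<and> (\<forall>x. le x y \<and> u \<le> F x \<longrightarrow> s u \<le> f x))" for f s
  define Q where "Q f = Sup (integral {0..1} ` {s. C f s})" for f
  have upper: "integral {0..1} s \<le> integral {0..1} t"
    if C: "C f s" and "t integrable_on {0..1}" and "\<And>u y. u \<in> {0..1} \<Longrightarrow> u \<le> F y \<Longrightarrow>
      (\<And>x. le x y \<Longrightarrow> u \<le> F x \<Longrightarrow> s u \<le> f x) \<Longrightarrow> s u \<le> t u" for f s t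
  proof (rule integral_le)
    show "s integrable_on {0..1}" using that(1) by (simp add: C_def)
    fix u :: real assume u: "u \<in> {0..1}"
    then obtain y where y: "u \<le> F y" "\<forall>x. le x y \<and> u \<le> F x \<longrightarrow> s u \<le> f x"
      using C unfolding C_def by blast
    show "s u \<le> t u" by (rule that(3)[OF u y(1)]) (use y(2) in blast)
  qed (rule that(2))
  have bdd: "bdd_above (integral {0..1} ` {s. C f s})" if f: "gamble f" for f
  proof -
    obtain K where K: "\<And>x. \<bar>f x\<bar> \<le> K" using f gambleE by blast
    show ?thesis
    proof (rule bdd_aboveI2)
      fix s assume "s \<in> {s. C f s}"
      then show "integral {0..1} s \<le> integral {0..1} (\<lambda>_::real. K)"
      proof (intro upper[of f])
        fix u y assume "u \<le> F y" "\<And>x. le x y \<Longrightarrow> u \<le> F x \<Longrightarrow> s u \<le> f x"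
        then have "s u \<le> f y" using tot[of y y] by blast
        then show "s u \<le> K" using K[of y] by linarith
      qed auto
    qed
  qed
  have lower: "integral {0..1} s \<le> Q f" if "gamble f" "C f s" for f s
    unfolding Q_def using bdd[OF that(1)] that(2) by (intro cSup_upper) auto
  have const: "C f (\<lambda>_. INF x. f x)" if "gamble f" for f
    unfolding C_def using gamble_bdd(1)[OF that] F01
    by (auto intro!: exI[of _ hi] cINF_lower)
  have ne: "{s. C f s} \<noteq> {}" if "gamble f" for f using const[OF that] by auto
  have scale: "C (\<lambda>x. c * f x) (\<lambda>u. c * s u)" if C: "C f s" and "0 \<le> c" for f s c
    unfolding C_def
  proof (intro conjI ballI)
    show "(\<lambda>u. c * s u) integrable_on {0..1}"
      using that(1) by (simp add: C_def integrable_on_mult_right)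
    fix u :: real assume "u \<in> {0..1}"
    then obtain y where "u \<le> F y" "\<forall>x. le x y \<and> u \<le> F x \<longrightarrow> s u \<le> f x"
      using C unfolding C_def by blast
    then show "\<exists>y. u \<le> F y \<and> (\<forall>x. le x y \<and> u \<le> F x \<longrightarrow> c * s u \<le> c * f x)"
      using that(2) by (intro exI[of _ y]) (simp add: mult_left_mono)
  qed
  have scaleQ: "c * Q f \<le> Q (\<lambda>x. c * f x)" if f: "gamble f" and "0 < c" for f c
  proof -
    have g: "gamble (\<lambda>x. c * f x)"
      using f unfolding gamble_def using bounded_scaling[of "range f" c] by (simp add: image_image)
    have "Q f \<le> Q (\<lambda>x. c * f x) / c"
      unfolding Q_def[of f]
    proof (rule cSUP_least[OF ne[OF f]])
      fix s assume "s \<in> {s. C f s}"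
      then have "integral {0..1} (\<lambda>u. c * s u) \<le> Q (\<lambda>x. c * f x)"
        using \<open>0 < c\<close> by (intro lower g scale) auto
      then show "integral {0..1} s \<le> Q (\<lambda>x. c * f x) / c"
        using \<open>0 < c\<close> by (simp add: field_simps)
    qed
    then show ?thesis using \<open>0 < c\<close> by (simp add: field_simps)
  qed
  have eqI: "Q f = integral {0..1} t" if "gamble f" "C f t" "\<And>s u y. u \<in> {0..1} \<Longrightarrow> u \<le> F y \<Longrightarrow>
      (\<And>x. le x y \<Longrightarrow> u \<le> F x \<Longrightarrow> s u \<le> f x) \<Longrightarrow> s u \<le> t u" for f t
  proof (rule antisym)
    show "Q f \<le> integral {0..1} t"
      unfolding Q_def
      by (rule cSUP_least[OF ne[OF that(1)]], rule upper[of f]) (use that in \<open>auto simp: C_def\<close>)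
  qed (rule lower[OF that(1,2)])
  have "coherent Q"
    unfolding coherent_def
  proof (intro conjI allI impI)
    fix f :: "'a \<Rightarrow> real" assume f: "gamble f"
    show "(INF x. f x) \<le> Q f" using lower[OF f const[OF f]] by simp
    fix c :: real assume "0 \<le> c"
    show "Q (\<lambda>x. c * f x) = c * Q f"
    proof (cases "c = 0")
      case True
      have "Q (\<lambda>_. 0) = integral {0..1} (\<lambda>_::real. 0)"
      proof (rule eqI)
        show "gamble (\<lambda>_. 0)" by (auto simp: gamble_def)
        show "C (\<lambda>_. 0) (\<lambda>_. 0)" using F01 by (auto simp: C_def intro: exI[of _ hi])
        show "s u \<le> 0" if "u \<le> F y" "\<And>x. le x y \<Longrightarrow> u \<le> F x \<Longrightarrow> s u \<le> 0" for s :: "real \<Rightarrow> real" and u y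
          using that tot[of y y] by blast
      qed
      then show ?thesis using True by simp
    next
      case False
      then have "c > 0" using \<open>0 \<le> c\<close> by simp
      have g: "gamble (\<lambda>x. c * f x)"
        using f unfolding gamble_def using bounded_scaling[of "range f" c] by (simp add: image_image)
      have "(1/c) * Q (\<lambda>x. c * f x) \<le> Q (\<lambda>x. (1/c) * (c * f x))"
        using \<open>c > 0\<close> by (intro scaleQ g) auto
      also have "\<dots> = Q f" using \<open>c > 0\<close> by simp
      finally have "Q (\<lambda>x. c * f x) \<le> c * Q f" using \<open>c > 0\<close> by (simp add: field_simps)
      with scaleQ[OF f \<open>c > 0\<close>] show ?thesis by simp
    qed
  next
    fix f g :: "'a \<Rightarrow> real" assume f: "gamble f" and g: "gamble g"
    have fg: "gamble (\<lambda>x. f x + g x)" using f g unfolding gamble_def by (rule bounded_plus_comp)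
    have sum: "integral {0..1} s + integral {0..1} t \<le> Q (\<lambda>x. f x + g x)" if s: "C f s" and t: "C g t" for s t
    proof -
      have "\<exists>y. u \<le> F y \<and> (\<forall>x. le x y \<and> u \<le> F x \<longrightarrow> s u + t u \<le> f x + g x)" if u: "u \<in> {0..1}" for u
      proof -
        obtain y z where yz: "u \<le> F y" "\<forall>x. le x y \<and> u \<le> F x \<longrightarrow> s u \<le> f x"
           "u \<le> F z" "\<forall>x. le x z \<and> u \<le> F x \<longrightarrow> t u \<le> g x"
          using s t u unfolding C_def by meson
        from tot[of y z] show ?thesis
        proof
          assume "le y z"
          then show ?thesis using yz trans by (intro exI[of _ y]) (auto intro!: add_mono)
        next
          assume "le z y"
          then show ?thesis using yz trans by (intro exI[of _ z]) (auto intro!: add_mono)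
        qed
      qed
      then have "C (\<lambda>x. f x + g x) (\<lambda>u. s u + t u)"
        using s t unfolding C_def by (auto intro: integrable_add)
      from lower[OF fg this] show ?thesis
        using s t by (simp add: C_def integral_add)
    qed
    have "Q f \<le> Q (\<lambda>x. f x + g x) - integral {0..1} t" if "C g t" for t
      unfolding Q_def[of f] by (rule cSUP_least[OF ne[OF f]]) (use sum that in \<open>fastforce\<close>)
    then have "integral {0..1} t \<le> Q (\<lambda>x. f x + g x) - Q f" if "C g t" for t
      using that by fastforce
    then have "Q g \<le> Q (\<lambda>x. f x + g x) - Q f"
      unfolding Q_def[of g] by (intro cSUP_least[OF ne[OF g]]) auto
    then show "Q f + Q g \<le> Q (\<lambda>x. f x + g x)" by simp
  qed
  moreover have "Q (indicator (closed_interval le lo x)) = F x" for x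
  proof -
    let ?t = "\<lambda>u. if u \<le> F x then 1 else (0::real)"
    have hi0: "(?t has_integral (F x - 0)) {0..1}"
    proof -
      have "((\<lambda>_. 1) has_integral (F x - 0)) {0..F x}"
        using has_integral_const_real[of "1::real" 0 "F x"] F01 by simp
      then have "((\<lambda>u. if u \<in> {0..F x} then 1 else 0) has_integral (F x - 0)) {0..1}"
        using F01 by (subst has_integral_restrict) auto
      then show ?thesis by (rule has_integral_eq[rotated]) auto
    qed
    have "Q (indicator (closed_interval le lo x)) = integral {0..1} ?t"
    proof (rule eqI[OF gamble_indicator])
      show "C (indicator (closed_interval le lo x)) ?t"
        unfolding C_def
      proof (intro conjI ballI)
        fix u :: real assume "u \<in> {0..1}"
        show "\<exists>y. u \<le> F y \<and> (\<forall>x'. le x' y \<and> u \<le> F x' \<longrightarrow> ?t u \<le> indicator (closed_interval le lo x) x')"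
          using F01 lo \<open>u \<in> {0..1}\<close>
          by (cases "u \<le> F x") (auto simp: closed_interval_def intro: exI[of _ x] exI[of _ hi])
      qed (use hi0 in blast)
      fix s :: "real \<Rightarrow> real" and u y
      assume "u \<le> F y" and s: "\<And>x'. le x' y \<Longrightarrow> u \<le> F x' \<Longrightarrow> s u \<le> indicator (closed_interval le lo x) x'"
      then have "s u \<le> indicator (closed_interval le lo x) y" using tot[of y y] by blast
      moreover have "u \<le> F x" if "le y x" using Fm[OF that] \<open>u \<le> F y\<close> by simp
      ultimately show "s u \<le> ?t u" by (cases "le y x") (auto simp: closed_interval_def lo)
    qed
    then show ?thesis using hi0 by (simp add: integral_unique)
  qed
  moreover have "Q (indicator (left_open_interval le x hi)) = 1 - F x" for x
  proof -
    let ?t = "\<lambda>u. if u \<le> F x then 0 else (1::real)"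
    have hi0: "(?t has_integral (1 - F x)) {0..1}"
    proof -
      have "((\<lambda>_. 1) has_integral (1 - F x)) {F x..1}"
        using has_integral_const_real[of "1::real" "F x" 1] F01 by simp
      then have "((\<lambda>u. if u \<in> {F x..1} then 1 else 0) has_integral (1 - F x)) {0..1}"
        using F01 by (subst has_integral_restrict) auto
      then show ?thesis by (rule has_integral_spike[of "{F x}", rotated 2]) auto
    qed
    have "Q (indicator (left_open_interval le x hi)) = integral {0..1} ?t"
    proof (rule eqI[OF gamble_indicator])
      show "C (indicator (left_open_interval le x hi)) ?t"
        unfolding C_def
      proof (intro conjI ballI)
        fix u :: real assume u: "u \<in> {0..1}"
        have "?t u \<le> indicator (left_open_interval le x hi) x'" if "u \<le> F x'" for x'
        proof (cases "u \<le> F x")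
          case False
          then have "\<not> le x' x" using that Fm[of x' x] by auto
          then show ?thesis using tot[of x x'] hi
            by (auto simp: left_open_interval_def strict_def)
        qed auto
        then show "\<exists>y. u \<le> F y \<and> (\<forall>x'. le x' y \<and> u \<le> F x' \<longrightarrow> ?t u \<le> indicator (left_open_interval le x hi) x')"
          using F01 u by (intro exI[of _ hi]) auto
      qed (use hi0 in blast)
      fix s :: "real \<Rightarrow> real" and u y
      assume y: "u \<le> F y" and s: "\<And>x'. le x' y \<Longrightarrow> u \<le> F x' \<Longrightarrow> s u \<le> indicator (left_open_interval le x hi) x'"
      have "s u \<le> 1" using s[OF _ y] tot[of y y] by (metis indicator_le_1 order_trans)
      moreover have "s u \<le> 0" if u: "u \<le> F x"
      proof (cases "le x y")
        case True
        then show ?thesis using s[OF True u] tot[of x x]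
          by (auto simp: left_open_interval_def strict_def)
      next
        case False
        then show ?thesis using s[OF _ y] tot[of y y]
          by (auto simp: left_open_interval_def strict_def)
      qed
      ultimately show "s u \<le> ?t u" by auto
    qed
    then show ?thesis using hi0 by (simp add: integral_unique)
  qed
  ultimately show ?thesis unfolding agrees_with_pbox_def by blast
qed

theorem natural_extension_exists:
  assumes "bounded_total_preorder le lo hi" and "pbox le hi Fl Fu"
  shows "\<exists>E. natural_extension le lo hi Fl Fu E"
proof -
  have F: "cdf le hi Fl" "cdf le hi Fu" "\<And>x. Fl x \<le> Fu x"
    using assms(2) unfolding pbox_def by auto
  obtain Ql Qu where Q: "coherent Ql" "agrees_with_pbox le lo hi Fl Fl Ql"
    "coherent Qu" "agrees_with_pbox le lo hi Fu Fu Qu"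
    using cdf_coherent_exists[OF assms(1)] F by metis
  define P where "P f = (INF R\<in>{Ql, Qu}. R f)" for f
  have P: "P f = min (Ql f) (Qu f)" for f
    by (simp add: P_def cInf_eq_Min)
  have "coherent P" unfolding P_def using Q by (intro coherent_INF) auto
  moreover have "agrees_with_pbox le lo hi Fl Fu P"
    using Q F(3) unfolding agrees_with_pbox_def P by simp
  ultimately have PM: "P \<in> {P. coherent P \<and> agrees_with_pbox le lo hi Fl Fu P}" (is "P \<in> ?M") by simp
  define E where "E f = (INF R\<in>?M. R f)" for f
  have "coherent E" unfolding E_def using PM by (intro coherent_INF) blast+
  moreover have "agrees_with_pbox le lo hi Fl Fu E"
  proof -
    have *: "E f = P f" if "\<And>R. R \<in> ?M \<Longrightarrow> R f = P f" for f
    proof -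
      have "(\<lambda>R. R f) ` ?M = {P f}" using PM that by blast
      then show ?thesis by (simp add: E_def)
    qed
    show ?thesis
      unfolding agrees_with_pbox_def
    proof (intro conjI allI)
      fix x
      have "E (indicator (closed_interval le lo x)) = P (indicator (closed_interval le lo x))"
        using PM by (intro *) (simp add: agrees_with_pbox_def)
      then show "E (indicator (closed_interval le lo x)) = Fl x"
        using PM by (simp add: agrees_with_pbox_def)
      have "E (indicator (left_open_interval le x hi)) = P (indicator (left_open_interval le x hi))"
        using PM by (intro *) (simp add: agrees_with_pbox_def)
      then show "E (indicator (left_open_interval le x hi)) = 1 - Fu x"
        using PM by (simp add: agrees_with_pbox_def)
    qed
  qed
  moreover have "E f \<le> R f" if "gamble f" "R \<in> ?M" for f R
    unfolding E_def using that
    by (intro cINF_lower bdd_belowI2[of _ "INF x. f x"]) (auto simp: coherent_def)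
  ultimately show ?thesis unfolding natural_extension_def by blast
qed

end

theory Submission
  imports Defs
begin

text \<open>
  A p-box is a random interval in disguise. Draw a level \<open>u\<close> uniformly from \<open>(0,1]\<close> and look at the
  \<open>u\<close>-quantiles of all distributions between \<open>Fl\<close> and \<open>Fu\<close>: they lie in every set \<open>(z, y]\<close> with
  \<open>Fu z < u \<le> Fl y\<close>, and in every \<open>[lo, y]\<close> with \<open>u \<le> Fl y\<close>. There need not be a smallest such
  set, but for fixed \<open>u\<close> they form a filter base (\<open>filter_bases_quantile_sets\<close>). Taking the supremum
  of a gamble's lower bounds along that base, and then the lower integral over \<open>u\<close>, gives a coherent
  lower prevision (\<open>coherent_lower_expectation\<close>) that agrees with the p-box
  (\<open>lower_expectation_agrees_with_pbox\<close>), so by minimality it lies above the natural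
  extension \<open>E\<close>.

  The value of this prevision at an event \<open>B\<close> is the measure of the levels \<open>u\<close> for which some
  quantile set fits into \<open>B\<close>. Quantile sets are nonempty and full, so one that fits into \<open>B\<close> fits
  into a full component of \<open>B\<close>. The levels belonging to a given component \<open>C\<close> form an interval, of
  positive length unless empty, and intervals of different components are disjoint. Hence only
  countably many are nonempty, and the value at \<open>B\<close> is the sum of their lengths.
  If \<open>u < w\<close> belong to \<open>C\<close>, then some \<open>(z, y] \<subseteq> C\<close> has \<open>Fu z < u\<close> and \<open>w \<le> Fl y\<close> (or the same
  holds with \<open>[lo, y]\<close>), and superadditivity yields \<open>E C \<ge> Fl y - Fu z \<ge> w - u\<close>. So the length
  belonging to \<open>C\<close> is at most \<open>E C\<close> (\<open>levels_measure_le\<close>), and \<open>E B\<close> is at most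
  the sum of the \<open>E C\<close>.

  The opposite inequality is superadditivity on disjoint events (\<open>coherent_sum_disjoint_le\<close>),
  and the formula for the conjugate is the first formula for the complement, which is open as well.
\<close>

section \<open>Coherent lower previsions\<close>

lemma gamble_const: "gamble (\<lambda>_. c)"
  unfolding gamble_def by (rule bounded_subset[of "{c}"]) auto

lemma gamble_add: "gamble f \<Longrightarrow> gamble g \<Longrightarrow> gamble (\<lambda>x. f x + g x)"
  unfolding gamble_def by (rule bounded_plus_comp)

lemma gamble_scale: "gamble f \<Longrightarrow> gamble (\<lambda>x. c * f x)" for f :: "'a \<Rightarrow> real"
  unfolding gamble_def using bounded_scaling[of "range f" c] by (simp add: image_image)

lemma coherent_superadd:
  "coherent E \<Longrightarrow> gamble f \<Longrightarrow> gamble g \<Longrightarrow> E f + E g \<le> E (\<lambda>x. f x + g x)"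
  unfolding coherent_def by blast

lemma coherent_lower_bound:
  assumes E: "coherent E" and f: "gamble f" and c: "\<And>x. c \<le> f x"
  shows "c \<le> E f"
proof -
  have "c \<le> (INF x. f x)" using c by (intro cINF_greatest) auto
  then show ?thesis using E f unfolding coherent_def by force
qed

lemma coherent_mono:
  assumes E: "coherent E" and f: "gamble f" and g: "gamble g" and le: "\<And>x. f x \<le> g x"
  shows "E f \<le> E g"
proof -
  let ?h = "\<lambda>x. g x + (-1) * f x"
  have h: "gamble ?h" by (intro gamble_add gamble_scale f g)
  have "E f + E ?h \<le> E (\<lambda>x. f x + ?h x)" by (rule coherent_superadd[OF E f h])
  moreover have "0 \<le> E ?h" by (rule coherent_lower_bound[OF E h]) (use le in simp)
  ultimately show ?thesis by simp
qed

lemma coherent_add_const: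
  assumes E: "coherent E" and f: "gamble f"
  shows "E (\<lambda>x. f x + c) = E f + c"
proof -
  have *: "E g + d \<le> E (\<lambda>x. g x + d)" if "gamble g" for g d
  proof -
    have "d \<le> E (\<lambda>_. d)" by (rule coherent_lower_bound[OF E]) (simp_all add: gamble_const)
    then show ?thesis using coherent_superadd[OF E that gamble_const[of d]] by linarith
  qed
  show ?thesis
    using *[OF f, of c] *[OF gamble_add[OF f gamble_const], of c "- c"] by simp
qed

lemma coherent_event_nonneg: "coherent E \<Longrightarrow> 0 \<le> E (indicator S)"
  by (rule coherent_lower_bound[where f = "indicator S"]) (simp_all add: gamble_indicator)

lemma coherent_event_mono:
  assumes "coherent E" and "S \<subseteq> T"
  shows "E (indicator S) \<le> E (indicator T)"
  by (rule coherent_mono[OF assms(1)])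
     (use assms(2) in \<open>auto simp: gamble_indicator indicator_def\<close>)

lemma conjugate_indicator:
  assumes "coherent E"
  shows "conjugate E (indicator B) = 1 - E (indicator (- B))"
proof -
  have "(\<lambda>x. - indicator B x) = (\<lambda>x. indicator (- B) x + (-1::real))"
    by (auto simp: indicator_def)
  then show ?thesis
    using coherent_add_const[OF assms gamble_indicator, of "- B" "-1"]
    by (simp add: conjugate_def del: diff_conv_add_uminus)
qed

lemma coherent_sum_disjoint_le:
  assumes E: "coherent E" and "finite K" and "disjoint K"
  shows "(\<Sum>S\<in>K. E (indicator S)) \<le> E (indicator (\<Union>K))"
  using assms(2,3)
proof (induction K)
  case empty
  then show ?case using coherent_event_nonneg[OF E, of "\<Union>{}"] by (simp only: sum.empty)
next
  case (insert S K)
  have "S \<inter> \<Union>K = {}"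
    using insert.hyps(2) insert.prems by (auto simp: disjoint_def)
  then have eq: "indicator (\<Union>(insert S K)) = (\<lambda>x. indicator S x + (indicator (\<Union>K) x :: real))"
    by (auto simp: indicator_def fun_eq_iff)
  have "disjoint K" using insert.prems by (simp add: pairwise_insert)
  then have "(\<Sum>S\<in>insert S K. E (indicator S)) \<le> E (indicator S) + E (indicator (\<Union>K))"
    using insert by simp
  also have "\<dots> \<le> E (indicator (\<Union>(insert S K)))"
    unfolding eq by (rule coherent_superadd[OF E gamble_indicator gamble_indicator])
  finally show ?case .
qed

section \<open>Lower expectations over random filter bases\<close>

text \<open>Each level \<open>u \<in> I\<close> carries a filter base \<open>N u\<close>, to be read as a set-valued random variable
  that is known only through ever smaller enclosing sets. The first conjunct says that \<open>I\<close> has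
  total mass \<open>1\<close>.\<close>

definition filter_bases :: "real set \<Rightarrow> (real \<Rightarrow> 'a set set) \<Rightarrow> bool" where
  "filter_bases I N \<longleftrightarrow> ((\<lambda>_. 1::real) has_integral 1) I \<and>
     (\<forall>u\<in>I. N u \<noteq> {} \<and> {} \<notin> N u \<and> (\<forall>S\<in>N u. \<forall>T\<in>N u. \<exists>R\<in>N u. R \<subseteq> S \<inter> T))"

definition minorant ::
    "real set \<Rightarrow> (real \<Rightarrow> 'a set set) \<Rightarrow> ('a \<Rightarrow> real) \<Rightarrow> (real \<Rightarrow> real) \<Rightarrow> bool" where
  "minorant I N f s \<longleftrightarrow> s integrable_on I \<and> (\<forall>u\<in>I. \<exists>S\<in>N u. \<forall>x\<in>S. s u \<le> f x)"

text \<open>The lower integral over \<open>u\<close> of the limit inferior of \<open>f\<close> along \<open>N u\<close>. Passing through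
  integrable minorants avoids asking that limit to depend measurably on \<open>u\<close>.\<close>

definition lower_expectation ::
    "real set \<Rightarrow> (real \<Rightarrow> 'a set set) \<Rightarrow> ('a \<Rightarrow> real) \<Rightarrow> real" where
  "lower_expectation I N f = Sup (integral I ` {s. minorant I N f s})"

lemma filter_bases_ex_member:
  assumes "filter_bases I N" and "u \<in> I" and "S \<in> N u"
  shows "\<exists>x. x \<in> S"
  using assms unfolding filter_bases_def by (metis ex_in_conv)

lemma has_integral_const_filter_bases:
  assumes "filter_bases I N"
  shows "((\<lambda>_. c) has_integral (c::real)) I"
  using has_integral_mult_right[of "\<lambda>_. 1::real" 1 I c] assms by (simp add: filter_bases_def)

lemma minorant_const:
  assumes "filter_bases I N" and "\<And>x. c \<le> f x"
  shows "minorant I N f (\<lambda>_. c)"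
  using has_integral_const_filter_bases[OF assms(1)] assms
  unfolding minorant_def filter_bases_def by blast

lemma integral_minorant_le:
  assumes s: "minorant I N f s" and t: "t integrable_on I"
    and le: "\<And>u S. u \<in> I \<Longrightarrow> S \<in> N u \<Longrightarrow> (\<And>x. x \<in> S \<Longrightarrow> s u \<le> f x) \<Longrightarrow> s u \<le> t u"
  shows "integral I s \<le> integral I t"
proof (rule integral_le)
  show "s integrable_on I" using s by (simp add: minorant_def)
  show "s u \<le> t u" if "u \<in> I" for u
    using s le[OF that] that unfolding minorant_def by blast
qed (rule t)

lemma minorant_bdd_above:
  assumes N: "filter_bases I N" and f: "gamble f"
  shows "bdd_above (integral I ` {s. minorant I N f s})"
proof -
  obtain K where K: "\<And>x. \<bar>f x\<bar> \<le> K" using f gambleE by blast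
  show ?thesis
  proof (rule bdd_aboveI2)
    fix s assume "s \<in> {s. minorant I N f s}"
    then show "integral I s \<le> integral I (\<lambda>_. K)"
    proof (intro integral_minorant_le[of I N f])
      show "(\<lambda>_. K) integrable_on I" using has_integral_const_filter_bases[OF N] by blast
      fix u S assume "u \<in> I" "S \<in> N u" and s: "\<And>x. x \<in> S \<Longrightarrow> s u \<le> f x"
      then obtain x where "x \<in> S" using filter_bases_ex_member[OF N] by blast
      then show "s u \<le> K" using s[of x] K[of x] by linarith
    qed simp
  qed
qed

lemma lower_expectation_ge:
  assumes "filter_bases I N" and "gamble f" and "minorant I N f s"
  shows "integral I s \<le> lower_expectation I N f"
  unfolding lower_expectation_def
  using minorant_bdd_above[OF assms(1,2)] assms(3) by (intro cSup_upper) auto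

lemma lower_expectation_le:
  assumes N: "filter_bases I N" and f: "gamble f"
    and le: "\<And>s. minorant I N f s \<Longrightarrow> integral I s \<le> c"
  shows "lower_expectation I N f \<le> c"
  unfolding lower_expectation_def
proof (rule cSUP_least)
  have "minorant I N f (\<lambda>_. INF x. f x)"
    using gamble_bdd(1)[OF f] by (intro minorant_const[OF N] cINF_lower) auto
  then show "{s. minorant I N f s} \<noteq> {}" by blast
qed (use le in auto)

lemma lower_expectation_eqI:
  assumes N: "filter_bases I N" and f: "gamble f" and t: "minorant I N f t"
    and le: "\<And>u S c. u \<in> I \<Longrightarrow> S \<in> N u \<Longrightarrow> (\<And>x. x \<in> S \<Longrightarrow> c \<le> f x) \<Longrightarrow> c \<le> t u"
  shows "lower_expectation I N f = integral I t"
proof (rule antisym)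
  show "lower_expectation I N f \<le> integral I t"
    by (intro lower_expectation_le[OF N f] integral_minorant_le) (use t le in \<open>auto simp: minorant_def\<close>)
qed (rule lower_expectation_ge[OF N f t])

text \<open>For an event the optimal minorant is itself an indicator: that of the levels \<open>u\<close> whose filter
  contains the event.\<close>

lemma lower_expectation_indicator_eqI:
  assumes N: "filter_bases I N" and U: "U \<in> lmeasurable" "U \<subseteq> I"
    and inU: "\<And>u. u \<in> U \<Longrightarrow> \<exists>S\<in>N u. S \<subseteq> A"
    and notinU: "\<And>u S. u \<in> I - U \<Longrightarrow> S \<in> N u \<Longrightarrow> \<not> S \<subseteq> A"
  shows "lower_expectation I N (indicator A) = measure lebesgue U"
proof -
  have UI: "U \<inter> I = U" using U by blast
  have "lower_expectation I N (indicator A) = integral I (indicator U)"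
  proof (rule lower_expectation_eqI[OF N gamble_indicator])
    show "minorant I N (indicator A) (indicator U)"
      unfolding minorant_def
    proof (intro conjI ballI)
      show "indicat_real U integrable_on I" using U UI by (simp add: integrable_on_indicator)
      fix u assume "u \<in> I"
      show "\<exists>S\<in>N u. \<forall>x\<in>S. indicat_real U u \<le> indicator A x"
      proof (cases "u \<in> U")
        case True
        then obtain S where "S \<in> N u" "S \<subseteq> A" using inU by blast
        then show ?thesis by (auto simp: indicator_def intro!: bexI[of _ S])
      next
        case False
        then show ?thesis using N \<open>u \<in> I\<close> unfolding filter_bases_def by force
      qed
    qed
    fix u S c assume u: "u \<in> I" "S \<in> N u" and c: "\<And>x. x \<in> S \<Longrightarrow> c \<le> indicat_real A x"
    show "c \<le> indicator U u"
    proof (cases "u \<in> U")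
      case True
      obtain x where "x \<in> S" using filter_bases_ex_member[OF N u] by blast
      then have "c \<le> indicat_real A x" by (rule c)
      also have "\<dots> \<le> 1" by (rule indicator_le_1)
      finally show ?thesis using True by simp
    next
      case False
      then obtain x where "x \<in> S" "x \<notin> A" using notinU u by blast
      with c[of x] show ?thesis using False by simp
    qed
  qed
  then show ?thesis using U by (simp add: integral_indicator UI)
qed

lemma minorant_scale:
  assumes "minorant I N f s" and "0 \<le> c"
  shows "minorant I N (\<lambda>x. c * f x) (\<lambda>u. c * s u)"
  unfolding minorant_def
proof (intro conjI ballI)
  show "(\<lambda>u. c * s u) integrable_on I"
    using assms(1) by (simp add: minorant_def integrable_on_mult_right)
  show "\<exists>S\<in>N u. \<forall>x\<in>S. c * s u \<le> c * f x" if "u \<in> I" for u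
    using assms that unfolding minorant_def by (meson mult_left_mono)
qed

lemma minorant_add:
  assumes N: "filter_bases I N" and s: "minorant I N f s" and t: "minorant I N g t"
  shows "minorant I N (\<lambda>x. f x + g x) (\<lambda>u. s u + t u)"
  unfolding minorant_def
proof (intro conjI ballI)
  show "(\<lambda>u. s u + t u) integrable_on I"
    using s t unfolding minorant_def by (blast intro: integrable_add)
  fix u assume u: "u \<in> I"
  obtain S T where "S \<in> N u" "T \<in> N u" and ST: "\<forall>x\<in>S. s u \<le> f x" "\<forall>x\<in>T. t u \<le> g x"
    using s t u unfolding minorant_def by blast
  then obtain R where "R \<in> N u" "R \<subseteq> S \<inter> T" using N u unfolding filter_bases_def by blast
  then show "\<exists>S\<in>N u. \<forall>x\<in>S. s u + t u \<le> f x + g x"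
    using ST by (intro bexI[of _ R]) (auto intro!: add_mono)
qed

text \<open>Superadditivity is where directedness enters: lower bounds of \<open>f\<close> and \<open>g\<close>, valid on two
  members of \<open>N u\<close>, are simultaneously valid on a common smaller one, so minorants add up.\<close>

lemma coherent_lower_expectation:
  assumes N: "filter_bases I N"
  shows "coherent (lower_expectation I N)" (is "coherent ?Q")
proof -
  have inf: "(INF x. f x) \<le> ?Q f" if f: "gamble f" for f
  proof -
    have "minorant I N f (\<lambda>_. INF x. f x)"
      using gamble_bdd(1)[OF f] by (intro minorant_const[OF N] cINF_lower) auto
    from lower_expectation_ge[OF N f this] show ?thesis
      by (simp add: integral_unique[OF has_integral_const_filter_bases[OF N]])
  qed
  have add: "?Q f + ?Q g \<le> ?Q (\<lambda>x. f x + g x)" if f: "gamble f" and g: "gamble g" for f g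
  proof -
    have "integral I s + integral I t \<le> ?Q (\<lambda>x. f x + g x)"
      if "minorant I N f s" "minorant I N g t" for s t
      using lower_expectation_ge[OF N gamble_add[OF f g] minorant_add[OF N that]] that
      by (simp add: minorant_def integral_add)
    then have "?Q f \<le> ?Q (\<lambda>x. f x + g x) - integral I t" if "minorant I N g t" for t
      using that by (intro lower_expectation_le[OF N f]) (simp add: le_diff_eq)
    then have "?Q g \<le> ?Q (\<lambda>x. f x + g x) - ?Q f"
      by (intro lower_expectation_le[OF N g]) (simp add: algebra_simps)
    then show ?thesis by simp
  qed
  have scale: "c * ?Q f \<le> ?Q (\<lambda>x. c * f x)" if f: "gamble f" and "0 < c" for f and c :: real
  proof -
    have "?Q f \<le> ?Q (\<lambda>x. c * f x) / c"
    proof (rule lower_expectation_le[OF N f])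
      fix s assume "minorant I N f s"
      then have "integral I (\<lambda>u. c * s u) \<le> ?Q (\<lambda>x. c * f x)"
        using \<open>0 < c\<close> by (intro lower_expectation_ge[OF N gamble_scale[OF f]] minorant_scale) auto
      then show "integral I s \<le> ?Q (\<lambda>x. c * f x) / c"
        using \<open>0 < c\<close> by (simp add: field_simps)
    qed
    then show ?thesis using \<open>0 < c\<close> by (simp add: field_simps)
  qed
  have "?Q (\<lambda>x. c * f x) = c * ?Q f" if f: "gamble f" and "0 \<le> c" for f c
  proof (cases "c = 0")
    case True
    \<comment> \<open>The value at the zero gamble is nonnegative, and at least twice itself.\<close>
    then show ?thesis
      using inf[OF gamble_const[of 0]] add[OF gamble_const[of 0] gamble_const[of 0]] by simp
  next
    case False
    then have "c > 0" using \<open>0 \<le> c\<close> by simp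
    then have "(1/c) * ?Q (\<lambda>x. c * f x) \<le> ?Q f"
      using scale[OF gamble_scale[OF f], of "1/c" c] by simp
    then have "?Q (\<lambda>x. c * f x) \<le> c * ?Q f" using \<open>c > 0\<close> by (simp add: field_simps)
    with scale[OF f \<open>c > 0\<close>] show ?thesis by simp
  qed
  with inf add show ?thesis unfolding coherent_def by blast
qed

section \<open>The random filter base of a p-box\<close>

text \<open>A quantile set has the form \<open>(z, y]\<close> or \<open>[lo, y]\<close>; writing it as an upper set intersected with
  the down-set of \<open>y\<close> treats both forms alike. The unbounded cut \<open>UNIV\<close> is there because no \<open>z\<close>
  with \<open>Fu z < u\<close> need exist.

  The intersection of all upper cuts is \<open>{x. u \<le> Fu x}\<close>, yet that set may not replace them: a finitely
  additive probability can put mass immediately below it, so the resulting prevision can exceed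
  the natural extension.\<close>

definition upper_cuts :: "('a \<Rightarrow> 'a \<Rightarrow> bool) \<Rightarrow> ('a \<Rightarrow> real) \<Rightarrow> real \<Rightarrow> 'a set set" where
  "upper_cuts le F u = insert UNIV ((\<lambda>z. {x. strict le z x}) ` {z. F z < u})"

definition quantile_sets ::
    "('a \<Rightarrow> 'a \<Rightarrow> bool) \<Rightarrow> ('a \<Rightarrow> real) \<Rightarrow> ('a \<Rightarrow> real) \<Rightarrow> real \<Rightarrow> 'a set set" where
  "quantile_sets le Fl Fu u = {T \<inter> {x. le x y} |T y. T \<in> upper_cuts le Fu u \<and> u \<le> Fl y}"

lemma quantile_setsE:
  assumes "S \<in> quantile_sets le Fl Fu u"
  obtains T y where "T \<in> upper_cuts le Fu u" "u \<le> Fl y" "S = T \<inter> {x. le x y}"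
  using assms unfolding quantile_sets_def by blast

lemma quantile_setsI:
  "T \<in> upper_cuts le Fu u \<Longrightarrow> u \<le> Fl y \<Longrightarrow> T \<inter> {x. le x y} \<in> quantile_sets le Fl Fu u"
  unfolding quantile_sets_def by blast

lemma UNIV_upper_cuts: "UNIV \<in> upper_cuts le F u"
  by (simp add: upper_cuts_def)

lemma strict_upper_cuts: "F z < u \<Longrightarrow> {x. strict le z x} \<in> upper_cuts le F u"
  by (simp add: upper_cuts_def)

lemma upper_cuts_mono: "u \<le> v \<Longrightarrow> upper_cuts le F u \<subseteq> upper_cuts le F v"
  by (auto simp: upper_cuts_def)

lemma upper_cuts_upward:
  assumes "bounded_total_preorder le lo hi" and "T \<in> upper_cuts le F u" and "x \<in> T" and "le x y"
  shows "y \<in> T"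
  using assms(2-) bounded_total_preorderD(2)[OF assms(1)]
  unfolding upper_cuts_def strict_def by blast

lemma upper_cuts_Int:
  assumes "bounded_total_preorder le lo hi"
    and S: "S \<in> upper_cuts le F u" and T: "T \<in> upper_cuts le F u"
  shows "S \<inter> T \<in> upper_cuts le F u"
proof -
  have "S \<subseteq> T \<or> T \<subseteq> S"
    using upper_cuts_upward[OF assms(1) S] upper_cuts_upward[OF assms(1) T]
      bounded_total_preorderD(3)[OF assms(1)] by (metis subsetI)
  then have "S \<inter> T = S \<or> S \<inter> T = T" by blast
  then show ?thesis using S T by metis
qed

lemma pboxD:
  assumes "pbox le hi Fl Fu"
  shows "0 \<le> Fl x" "Fl x \<le> 1" "0 \<le> Fu x" "Fu x \<le> 1" "Fl hi = 1" "Fu hi = 1" "Fl x \<le> Fu x"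
    and "le x y \<Longrightarrow> Fl x \<le> Fl y" "le x y \<Longrightarrow> Fu x \<le> Fu y"
  using assms unfolding pbox_def cdf_def by (auto simp: monotone_def image_subset_iff)

text \<open>As \<open>Fu\<close> is monotone, \<open>Fu z < u \<le> Fu y\<close> forces \<open>z\<close> strictly below \<open>y\<close>.\<close>

lemma mem_upper_cuts:
  assumes ord: "bounded_total_preorder le lo hi" and F: "pbox le hi Fl Fu"
    and T: "T \<in> upper_cuts le Fu u" and y: "u \<le> Fu y"
  shows "y \<in> T"
proof -
  have "strict le z y" if "Fu z < u" for z
    using that y pboxD(9)[OF F, of y z] bounded_total_preorderD(3)[OF ord, of z y]
    unfolding strict_def by force
  then show ?thesis using T by (auto simp: upper_cuts_def)
qed

text \<open>Quantile sets are nonempty because \<open>Fl \<le> Fu\<close>: from \<open>u \<le> Fl y \<le> Fu y\<close> the right endpoint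
  \<open>y\<close> lies above every upper cut.\<close>

lemma mem_quantile_set:
  assumes "bounded_total_preorder le lo hi" and F: "pbox le hi Fl Fu"
    and "T \<in> upper_cuts le Fu u" and "u \<le> Fl y"
  shows "y \<in> T \<inter> {x. le x y}"
  using mem_upper_cuts[OF assms(1-3), of y] assms(4) pboxD(7)[OF F, of y]
    bounded_total_preorderD(1)[OF assms(1)] by auto

lemma quantile_set_full:
  assumes ord: "bounded_total_preorder le lo hi" and "S \<in> quantile_sets le Fl Fu u"
  shows "full le S"
proof -
  obtain T y where "T \<in> upper_cuts le Fu u" "S = T \<inter> {x. le x y}"
    using assms(2) by (rule quantile_setsE)
  then show ?thesis
    using upper_cuts_upward[OF ord] bounded_total_preorderD(2)[OF ord]
    unfolding full_def closed_interval_def by blast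
qed

lemma filter_bases_quantile_sets:
  assumes ord: "bounded_total_preorder le lo hi" and F: "pbox le hi Fl Fu"
  shows "filter_bases {0<..1} (quantile_sets le Fl Fu)"
  unfolding filter_bases_def
proof (intro conjI ballI)
  have "((\<lambda>_. 1::real) has_integral 1) {0..1::real}"
    using has_integral_const_real[of "1::real" 0 1] by simp
  moreover have "negligible {u \<in> {0..1::real} - {0<..1}. (1::real) \<noteq> 0}"
    by (rule negligible_subset[OF negligible_sing[of "0::real"]]) auto
  moreover have "negligible {u \<in> {0<..1} - {0..1::real}. (1::real) \<noteq> 0}"
    by (rule negligible_subset[OF negligible_empty]) auto
  ultimately show "((\<lambda>_. 1::real) has_integral 1) {0<..1::real}"
    using has_integral_spike_set_eq[of "{0..1::real}" "{0<..1}" "\<lambda>_. 1::real" 1] by blast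
  fix u :: real assume u: "u \<in> {0<..1}"
  then have "UNIV \<inter> {x. le x hi} \<in> quantile_sets le Fl Fu u"
    using pboxD(5)[OF F] by (intro quantile_setsI UNIV_upper_cuts) auto
  then show "quantile_sets le Fl Fu u \<noteq> {}" by blast
  show "{} \<notin> quantile_sets le Fl Fu u"
    using mem_quantile_set[OF ord F] by (metis empty_iff quantile_setsE)
  fix S1 S2 assume "S1 \<in> quantile_sets le Fl Fu u" "S2 \<in> quantile_sets le Fl Fu u"
  then obtain T1 y1 T2 y2 where S: "T1 \<in> upper_cuts le Fu u" "u \<le> Fl y1" "S1 = T1 \<inter> {x. le x y1}"
    "T2 \<in> upper_cuts le Fu u" "u \<le> Fl y2" "S2 = T2 \<inter> {x. le x y2}"
    by (metis quantile_setsE)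
  obtain y where y: "u \<le> Fl y" "le y y1" "le y y2"
    using S(2,5) bounded_total_preorderD(1,3)[OF ord] by metis
  have "(T1 \<inter> T2) \<inter> {x. le x y} \<in> quantile_sets le Fl Fu u"
    using S y by (intro quantile_setsI upper_cuts_Int[OF ord])
  moreover have "(T1 \<inter> T2) \<inter> {x. le x y} \<subseteq> S1 \<inter> S2"
    using S y bounded_total_preorderD(2)[OF ord] by blast
  ultimately show "\<exists>R\<in>quantile_sets le Fl Fu u. R \<subseteq> S1 \<inter> S2" by blast
qed

text \<open>The quantile sets at level \<open>u\<close> fit into \<open>[lo, x]\<close> from some point on exactly if \<open>u \<le> Fl x\<close>, and
  into \<open>(x, hi]\<close> exactly if \<open>Fu x < u\<close>.\<close>

lemma lower_expectation_agrees_with_pbox: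
  assumes ord: "bounded_total_preorder le lo hi" and F: "pbox le hi Fl Fu"
  shows "agrees_with_pbox le lo hi Fl Fu (lower_expectation {0<..1} (quantile_sets le Fl Fu))"
    (is "agrees_with_pbox _ _ _ _ _ ?Q")
proof -
  note N = filter_bases_quantile_sets[OF ord F]
  note refl = bounded_total_preorderD(1)[OF ord] and lo = bounded_total_preorderD(4)[OF ord]
  have "?Q (indicator (closed_interval le lo x)) = Fl x" for x
  proof -
    have "?Q (indicator (closed_interval le lo x)) = measure lebesgue {0<..Fl x}"
    proof (rule lower_expectation_indicator_eqI[OF N])
      fix u assume "u \<in> {0<..Fl x}"
      then have "UNIV \<inter> {x'. le x' x} \<in> quantile_sets le Fl Fu u"
        by (intro quantile_setsI UNIV_upper_cuts) auto
      then show "\<exists>S\<in>quantile_sets le Fl Fu u. S \<subseteq> closed_interval le lo x"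
        by (rule bexI[rotated]) (auto simp: closed_interval_def lo)
    next
      fix u S assume u: "u \<in> {0<..1} - {0<..Fl x}" and "S \<in> quantile_sets le Fl Fu u"
      then obtain T y where y: "T \<in> upper_cuts le Fu u" "u \<le> Fl y" "S = T \<inter> {x. le x y}"
        using quantile_setsE by metis
      have "y \<in> S" using mem_quantile_set[OF ord F y(1,2)] y(3) by simp
      moreover have "\<not> le y x" using pboxD(8)[OF F, of y x] u y(2) by auto
      ultimately show "\<not> S \<subseteq> closed_interval le lo x" by (auto simp: closed_interval_def)
    next
      show "{0<..Fl x} \<in> lmeasurable"
        by (intro measurable_convex) (auto intro: bounded_subset[OF bounded_closed_interval[of 0 "Fl x"]])
    qed (use pboxD(2)[OF F, of x] in auto)
    then show ?thesis using pboxD(1)[OF F, of x] by simp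
  qed
  moreover have "?Q (indicator (left_open_interval le x hi)) = 1 - Fu x" for x
  proof -
    have "?Q (indicator (left_open_interval le x hi)) = measure lebesgue {Fu x<..1}"
    proof (rule lower_expectation_indicator_eqI[OF N])
      fix u assume "u \<in> {Fu x<..1}"
      then have "{x'. strict le x x'} \<inter> {x. le x hi} \<in> quantile_sets le Fl Fu u"
        using pboxD(5)[OF F] by (intro quantile_setsI strict_upper_cuts) auto
      then show "\<exists>S\<in>quantile_sets le Fl Fu u. S \<subseteq> left_open_interval le x hi"
        by (rule bexI[rotated]) (auto simp: left_open_interval_def)
    next
      fix u S assume u: "u \<in> {0<..1} - {Fu x<..1}" and "S \<in> quantile_sets le Fl Fu u"
      then obtain T y where y: "T \<in> upper_cuts le Fu u" "u \<le> Fl y" "S = T \<inter> {x. le x y}"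
        using quantile_setsE by metis
      \<comment> \<open>The smaller of \<open>x\<close> and \<open>y\<close> lies in the quantile set but not above \<open>x\<close>.\<close>
      have yS: "y \<in> S" using mem_quantile_set[OF ord F y(1,2)] y(3) by simp
      have xT: "x \<in> T" using mem_upper_cuts[OF ord F y(1)] u by auto
      show "\<not> S \<subseteq> left_open_interval le x hi"
      proof (cases "le x y")
        case True
        then have "x \<in> S" using xT y(3) by blast
        then show ?thesis using refl by (auto simp: left_open_interval_def strict_def)
      next
        case False
        then show ?thesis using yS by (auto simp: left_open_interval_def strict_def)
      qed
    next
      show "{Fu x<..1} \<in> lmeasurable"
        by (intro measurable_convex) (auto intro: bounded_subset[OF bounded_closed_interval[of "Fu x" 1]])
    qed (use pboxD(3)[OF F, of x] in auto)
    then show ?thesis using pboxD(4)[OF F, of x] by simp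
  qed
  ultimately show ?thesis unfolding agrees_with_pbox_def by blast
qed

section \<open>The levels carried by a full component\<close>

definition levels ::
    "('a \<Rightarrow> 'a \<Rightarrow> bool) \<Rightarrow> ('a \<Rightarrow> real) \<Rightarrow> ('a \<Rightarrow> real) \<Rightarrow> 'a set \<Rightarrow> real set" where
  "levels le Fl Fu C = {u \<in> {0<..1}. \<exists>S\<in>quantile_sets le Fl Fu u. S \<subseteq> C}"

text \<open>For a cut at \<open>z\<close> this is superadditivity applied to \<open>[lo, y]\<close> and \<open>(z, hi]\<close>, whose indicators
  sum to at most \<open>1\<close> plus that of \<open>(z, y]\<close>. For the trivial cut the value is \<open>Fl y\<close>, and positivity
  of \<open>u\<close> is what makes \<open>w - u\<close> a lower bound.\<close>

lemma coherent_cut_ge: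
  assumes ord: "bounded_total_preorder le lo hi" and E: "coherent E"
    and agr: "agrees_with_pbox le lo hi Fl Fu E"
    and T: "T \<in> upper_cuts le Fu u" and u: "0 < u" and w: "w \<le> Fl y"
  shows "w - u \<le> E (indicator (T \<inter> {x. le x y}))"
proof -
  have cl: "closed_interval le lo y = {x. le x y}"
    using bounded_total_preorderD(4)[OF ord] by (simp add: closed_interval_def)
  have Ey: "E (indicator {x. le x y}) = Fl y"
    using agr cl unfolding agrees_with_pbox_def by metis
  show ?thesis
  proof (cases "T = UNIV")
    case True
    then show ?thesis using Ey u w by simp
  next
    case False
    then obtain z where z: "Fu z < u" "T = {x. strict le z x}"
      using T by (auto simp: upper_cuts_def)
    have "left_open_interval le z hi = T"
      using z bounded_total_preorderD(5)[OF ord] by (simp add: left_open_interval_def)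
    then have ET: "E (indicator T) = 1 - Fu z"
      using agr unfolding agrees_with_pbox_def by metis
    let ?i = "indicator (T \<inter> {x. le x y}) :: 'a \<Rightarrow> real"
    have "Fl y + (1 - Fu z) \<le> E (\<lambda>x. indicator {x. le x y} x + indicator T x)"
      using coherent_superadd[OF E gamble_indicator gamble_indicator] Ey ET by metis
    also have "\<dots> \<le> E (\<lambda>x. ?i x + 1)"
      by (intro coherent_mono[OF E] gamble_add gamble_indicator gamble_const)
         (auto simp: indicator_def)
    also have "\<dots> = E ?i + 1" by (rule coherent_add_const[OF E gamble_indicator])
    finally show ?thesis using z u w by simp
  qed
qed

text \<open>The lower end of a quantile set for \<open>u\<close> and the upper end of one for \<open>w\<close> combine into a single set
  that still fits into \<open>C\<close>, because fullness fills the gap between the two. It serves for all levels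
  from \<open>u\<close> to \<open>w\<close>.\<close>

lemma levels_witness:
  assumes ord: "bounded_total_preorder le lo hi" and F: "pbox le hi Fl Fu" and C: "full le C"
    and u: "u \<in> levels le Fl Fu C" and w: "w \<in> levels le Fl Fu C" and "u \<le> w"
  obtains T y where "T \<in> upper_cuts le Fu u" "w \<le> Fl y" "T \<inter> {x. le x y} \<subseteq> C"
proof -
  obtain T y where T: "T \<in> upper_cuts le Fu u" "u \<le> Fl y" "T \<inter> {x. le x y} \<subseteq> C"
    using u unfolding levels_def by (auto elim!: quantile_setsE)
  obtain T' y' where T': "T' \<in> upper_cuts le Fu w" "w \<le> Fl y'" "T' \<inter> {x. le x y'} \<subseteq> C"
    using w unfolding levels_def by (auto elim!: quantile_setsE)
  have y: "y \<in> C" "y' \<in> C"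
    using mem_quantile_set[OF ord F T(1,2)] mem_quantile_set[OF ord F T'(1,2)] T(3) T'(3) by auto
  have "T \<inter> {x. le x y'} \<subseteq> C"
  proof
    fix x assume x: "x \<in> T \<inter> {x. le x y'}"
    show "x \<in> C"
    proof (cases "le x y")
      case True
      then show ?thesis using x T(3) by blast
    next
      case False
      then have "le y x" using bounded_total_preorderD(3)[OF ord] by blast
      moreover have "le y y'" using bounded_total_preorderD(2)[OF ord \<open>le y x\<close>] x by blast
      ultimately show ?thesis using C y x unfolding full_def closed_interval_def by blast
    qed
  qed
  with T(1) T'(2) show thesis by (rule that)
qed

lemma levels_length_le:
  assumes ord: "bounded_total_preorder le lo hi" and F: "pbox le hi Fl Fu" and C: "full le C"
    and E: "coherent E" "agrees_with_pbox le lo hi Fl Fu E"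
    and u: "u \<in> levels le Fl Fu C" and w: "w \<in> levels le Fl Fu C" 
  shows "w - u \<le> E (indicator C)"
proof (cases "u \<le> w")
  case True
  obtain T y where T: "T \<in> upper_cuts le Fu u" "w \<le> Fl y" "T \<inter> {x. le x y} \<subseteq> C"
    using levels_witness[OF ord F C u w True] .
  have "w - u \<le> E (indicator (T \<inter> {x. le x y}))"
    using u by (intro coherent_cut_ge[OF ord E T(1) _ T(2)]) (simp add: levels_def)
  also have "\<dots> \<le> E (indicator C)" by (rule coherent_event_mono[OF E(1) T(3)])
  finally show ?thesis .
next
  case False
  then show ?thesis using coherent_event_nonneg[OF E(1), of C] by simp
qed

text \<open>Measurability comes from the levels of \<open>C\<close> being an interval.\<close>

lemma levels_lmeasurable:
  assumes ord: "bounded_total_preorder le lo hi" and F: "pbox le hi Fl Fu" and C: "full le C"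
  shows "levels le Fl Fu C \<in> lmeasurable"
proof (rule measurable_convex)
  have "v \<in> levels le Fl Fu C"
    if u: "u \<in> levels le Fl Fu C" and w: "w \<in> levels le Fl Fu C" and v: "u \<le> v" "v \<le> w" for u v w
  proof -
    have "u \<le> w" using v by simp
    obtain T y where T: "T \<in> upper_cuts le Fu u" "w \<le> Fl y" "T \<inter> {x. le x y} \<subseteq> C"
      using levels_witness[OF ord F C u w \<open>u \<le> w\<close>] .
    then have "T \<inter> {x. le x y} \<in> quantile_sets le Fl Fu v"
      using v upper_cuts_mono[of u v le Fu] by (intro quantile_setsI) auto
    then show ?thesis using T(3) u w v unfolding levels_def by auto
  qed
  then show "convex (levels le Fl Fu C)"
    unfolding is_interval_convex_1[symmetric] is_interval_1 by blast
  show "bounded (levels le Fl Fu C)"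
    by (rule bounded_subset[OF bounded_closed_interval[of 0 1]]) (auto simp: levels_def)
qed

lemma measure_le_length:
  fixes U :: "real set"
  assumes U: "U \<in> lmeasurable" "bounded U" and "0 \<le> d"
    and d: "\<And>u w. u \<in> U \<Longrightarrow> w \<in> U \<Longrightarrow> w - u \<le> d"
  shows "measure lebesgue U \<le> d"
proof (cases "U = {}")
  case True
  then show ?thesis using \<open>0 \<le> d\<close> by simp
next
  case False
  have bdd: "bdd_below U" "bdd_above U"
    using U(2) by (auto intro: bounded_imp_bdd_below bounded_imp_bdd_above)
  have "U \<subseteq> {Inf U..Sup U}" using bdd by (auto intro: cInf_lower cSup_upper)
  then have "measure lebesgue U \<le> measure lebesgue {Inf U..Sup U}"
    using U(1) by (intro measure_mono_fmeasurable) auto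
  also have "\<dots> = Sup U - Inf U"
    using False bdd by (simp add: cInf_le_cSup)
  also have "Sup U \<le> Inf U + d"
  proof (rule cSup_least[OF False])
    fix w assume "w \<in> U"
    then have "w - d \<le> Inf U" using d by (intro cInf_greatest[OF False]) (simp add: algebra_simps)
    then show "w \<le> Inf U + d" by simp
  qed
  finally show ?thesis by simp
qed

lemma levels_measure_le:
  assumes ord: "bounded_total_preorder le lo hi" and F: "pbox le hi Fl Fu" and C: "full le C"
    and E: "coherent E" "agrees_with_pbox le lo hi Fl Fu E"
  shows "measure lebesgue (levels le Fl Fu C) \<le> E (indicator C)"
proof (rule measure_le_length)
  show "bounded (levels le Fl Fu C)"
    by (rule bounded_subset[OF bounded_closed_interval[of 0 1]]) (auto simp: levels_def)
qed (use levels_lmeasurable[OF ord F C] levels_length_le[OF ord F C E] coherent_event_nonneg[OF E(1)]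
     in auto)

text \<open>Two quantile sets of the same level contain a common one, which is nonempty.\<close>

lemma levels_disjoint:
  assumes ord: "bounded_total_preorder le lo hi" and F: "pbox le hi Fl Fu" and "C \<inter> D = {}"
  shows "levels le Fl Fu C \<inter> levels le Fl Fu D = {}"
proof (rule equals0I)
  fix u assume "u \<in> levels le Fl Fu C \<inter> levels le Fl Fu D"
  then obtain S S' where S: "S \<in> quantile_sets le Fl Fu u" "S \<subseteq> C"
    "S' \<in> quantile_sets le Fl Fu u" "S' \<subseteq> D" and u: "u \<in> {0<..1}"
    unfolding levels_def by blast
  note N = filter_bases_quantile_sets[OF ord F]
  obtain R where "R \<in> quantile_sets le Fl Fu u" "R \<subseteq> S \<inter> S'"
    using N S(1,3) u unfolding filter_bases_def by metis
  then show False using filter_bases_ex_member[OF N u] S(2,4) assms(3) by blast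
qed

text \<open>The condition \<open>Fu z < u \<le> Fl y\<close> is left open in \<open>u\<close>, so a quantile set for \<open>u\<close> is one for all
  slightly smaller levels as well. Without this, uncountably many components could have
  one-point level sets.\<close>

lemma interior_levels_nonempty:
  assumes ord: "bounded_total_preorder le lo hi" and F: "pbox le hi Fl Fu"
    and u: "u \<in> levels le Fl Fu C"
  shows "interior (levels le Fl Fu C) \<noteq> {}"
proof -
  obtain T y where T: "T \<in> upper_cuts le Fu u" "u \<le> Fl y" "T \<inter> {x. le x y} \<subseteq> C" and u01: "0 < u"
    using u unfolding levels_def by (auto elim!: quantile_setsE)
  \<comment> \<open>\<open>a\<close> is \<open>Fu z\<close> for a cut at \<open>z\<close>, and \<open>0\<close> for the trivial cut.\<close>
  obtain a where a: "0 \<le> a" "a < u" "\<And>v. a < v \<Longrightarrow> T \<in> upper_cuts le Fu v"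
    using T(1) u01 pboxD(3)[OF F] by (auto simp: upper_cuts_def)
  have "{a<..<u} \<subseteq> levels le Fl Fu C"
  proof
    fix v assume v: "v \<in> {a<..<u}"
    then have "T \<inter> {x. le x y} \<in> quantile_sets le Fl Fu v"
      using a(3) T(2) by (intro quantile_setsI) auto
    then show "v \<in> levels le Fl Fu C"
      using T(3) v a(1) u by (auto simp: levels_def)
  qed
  then have "{a<..<u} \<subseteq> interior (levels le Fl Fu C)" by (simp add: interior_maximal)
  moreover have "{a<..<u} \<noteq> {}" using a(2) by simp
  ultimately show ?thesis by blast
qed

section \<open>Additivity over full components\<close>

lemma full_components_partition:
  assumes ord: "bounded_total_preorder le lo hi" and A: "openin (partition_topology le) A"
  shows "disjoint (full_components le A)" and "\<Union>(full_components le A) \<subseteq> A"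
    and "\<And>C. C \<in> full_components le A \<Longrightarrow> full le C"
    and "\<And>S. full le S \<Longrightarrow> S \<noteq> {} \<Longrightarrow> S \<subseteq> A \<Longrightarrow> \<exists>C\<in>full_components le A. S \<subseteq> C"
proof -
  note fc = full_component_greatest[OF ord A]
  have eq: "full_component le A w = full_component le A x"
    if "x \<in> A" "w \<in> full_component le A x" for w x
  proof -
    have "w \<in> A" using fc(3)[OF that(1)] that(2) by blast
    then have "full_component le A x \<subseteq> full_component le A w"
      using fc[OF that(1)] fc(4)[OF \<open>w \<in> A\<close>] that(2) by blast
    moreover from this have "x \<in> full_component le A w" using fc(2)[OF that(1)] by blast
    then have "full_component le A w \<subseteq> full_component le A x"
      using fc[OF \<open>w \<in> A\<close>] fc(4)[OF that(1)] by blast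
    ultimately show ?thesis by blast
  qed
  have "C \<inter> D = {}" if "C \<in> full_components le A" "D \<in> full_components le A" "C \<noteq> D" for C D
  proof (rule equals0I)
    fix w assume w: "w \<in> C \<inter> D"
    obtain x y where "x \<in> A" "C = full_component le A x" "y \<in> A" "D = full_component le A y"
      using \<open>C \<in> _\<close> \<open>D \<in> _\<close> unfolding full_components_def by auto
    then show False using w eq[of x w] eq[of y w] \<open>C \<noteq> D\<close> by simp
  qed
  then show "disjoint (full_components le A)" by (rule disjointI)
  show "\<Union>(full_components le A) \<subseteq> A"
    unfolding full_components_def using fc(3) by blast
  show "full le C" if "C \<in> full_components le A" for C
    using that fc(1) unfolding full_components_def by auto
  show "\<exists>C\<in>full_components le A. S \<subseteq> C" if "full le S" "S \<noteq> {}" "S \<subseteq> A" for S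
  proof -
    obtain x where x: "x \<in> S" using \<open>S \<noteq> {}\<close> by blast
    then have "x \<in> A" using \<open>S \<subseteq> A\<close> by blast
    then have "S \<subseteq> full_component le A x" using that(1) x that(3) by (rule fc(4))
    then show ?thesis using \<open>x \<in> A\<close> unfolding full_components_def by blast
  qed
qed

text \<open>A possibly uncountable family of components contributes to the measure only through countably
  many disjoint level intervals, so its measure is controlled by finite subfamilies.\<close>

lemma lower_expectation_event_le:
  assumes ord: "bounded_total_preorder le lo hi" and F: "pbox le hi Fl Fu"
    and A: "openin (partition_topology le) A"
    and E: "coherent E" "agrees_with_pbox le lo hi Fl Fu E"
    and bound: "\<And>K. finite K \<Longrightarrow> K \<subseteq> full_components le A \<Longrightarrow> (\<Sum>C\<in>K. E (indicator C)) \<le> c"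
  shows "lower_expectation {0<..1} (quantile_sets le Fl Fu) (indicator A) \<le> c"
proof -
  let ?L = "levels le Fl Fu" and ?K = "full_components le A"
  note parts = full_components_partition[OF ord A] and N = filter_bases_quantile_sets[OF ord F]
  let ?V = "\<Union>(?L ` ?K)"
  have countable: "countable (?L ` ?K)"
  proof (rule countable_disjoint_nonempty_interior_subsets)
    have "?L C \<inter> ?L D = {}" if "C \<in> ?K" "D \<in> ?K" "?L C \<noteq> ?L D" for C D
      using that parts(1) by (intro levels_disjoint[OF ord F]) (auto dest: disjointD)
    then show "pairwise disjnt (?L ` ?K)" by (auto simp: pairwise_def disjnt_def)
    fix U assume U: "U \<in> ?L ` ?K" "interior U = {}"
    then obtain C where "U = ?L C" by blast
    then show "U = {}" using interior_levels_nonempty[OF ord F, of _ C] U(2) by auto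
  qed
  have meas: "U \<in> lmeasurable" if "U \<in> ?L ` ?K" for U
    using that levels_lmeasurable[OF ord F parts(3)] by auto
  have fin: "measure lebesgue (\<Union>\<U>) \<le> c" if \<U>: "\<U> \<subseteq> ?L ` ?K" "finite \<U>" for \<U>
  proof -
    obtain K where K: "K \<subseteq> ?K" "finite K" "\<U> = ?L ` K" using finite_subset_image[OF \<U>(2,1)] by blast
    have "measure lebesgue (\<Union>(?L ` K)) \<le> (\<Sum>C\<in>K. measure lebesgue (?L C))"
      using meas K(1) by (intro measure_UNION_le K(2) fmeasurableD) blast
    also have "\<dots> \<le> (\<Sum>C\<in>K. E (indicator C))"
      using K(1) parts(3) by (intro sum_mono levels_measure_le[OF ord F _ E]) blast
    also have "\<dots> \<le> c" using bound K by blast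
    finally show ?thesis using K(3) by simp
  qed
  have V: "?V \<in> lmeasurable" "measure lebesgue ?V \<le> c"
    using fmeasurable_Union_bound[OF countable meas fin] measure_Union_bound[OF countable meas fin]
    by blast+
  have VI: "?V \<inter> {0<..1} = ?V" by (auto simp: levels_def)
  have "lower_expectation {0<..1} (quantile_sets le Fl Fu) (indicator A) = measure lebesgue ?V"
  proof (rule lower_expectation_indicator_eqI[OF N V(1)])
    show "\<exists>S\<in>quantile_sets le Fl Fu u. S \<subseteq> A" if "u \<in> ?V" for u
      using that parts(2) unfolding levels_def by blast
    fix u S assume u: "u \<in> {0<..1} - ?V" and S: "S \<in> quantile_sets le Fl Fu u"
    show "\<not> S \<subseteq> A"
    proof
      assume "S \<subseteq> A"
      moreover have "S \<noteq> {}" using filter_bases_ex_member[OF N _ S] u by blast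
      ultimately obtain C where "C \<in> ?K" "S \<subseteq> C"
        using parts(4)[OF quantile_set_full[OF ord S]] by blast
      then have "u \<in> ?V" using S u unfolding levels_def by blast
      then show False using u by blast
    qed
  qed (use VI in blast)
  then show ?thesis using V(2) by simp
qed

lemma natural_extension_full_components:
  assumes ord: "bounded_total_preorder le lo hi" and F: "pbox le hi Fl Fu"
    and E: "natural_extension le lo hi Fl Fu E"
    and A: "openin (partition_topology le) A"
  shows "(\<lambda>C. E (indicator C)) summable_on full_components le A"
    and "E (indicator A) = (\<Sum>\<^sub>\<infinity>C\<in>full_components le A. E (indicator C))"
proof -
  let ?K = "full_components le A" and ?Q = "lower_expectation {0<..1} (quantile_sets le Fl Fu)"
  note parts = full_components_partition[OF ord A]
  have coh: "coherent E" and agr: "agrees_with_pbox le lo hi Fl Fu E"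
    and least: "\<And>P f. coherent P \<Longrightarrow> agrees_with_pbox le lo hi Fl Fu P \<Longrightarrow> gamble f \<Longrightarrow> E f \<le> P f"
    using E unfolding natural_extension_def by blast+
  have partial: "(\<Sum>C\<in>K. E (indicator C)) \<le> E (indicator A)" if K: "finite K" "K \<subseteq> ?K" for K
  proof -
    have "disjoint K" using parts(1) K(2) by (rule pairwise_subset)
    then have "(\<Sum>C\<in>K. E (indicator C)) \<le> E (indicator (\<Union>K))"
      by (rule coherent_sum_disjoint_le[OF coh K(1)])
    also have "\<dots> \<le> E (indicator A)" using K(2) parts(2) by (intro coherent_event_mono[OF coh]) blast
    finally show ?thesis .
  qed
  show sum: "(\<lambda>C. E (indicator C)) summable_on ?K"
    by (rule nonneg_bdd_above_summable_on)
       (use partial coherent_event_nonneg[OF coh] in \<open>auto intro!: bdd_aboveI2\<close>)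
  show "E (indicator A) = (\<Sum>\<^sub>\<infinity>C\<in>?K. E (indicator C))"
  proof (rule antisym)
    have "E (indicator A) \<le> ?Q (indicator A)"
      by (intro least gamble_indicator lower_expectation_agrees_with_pbox[OF ord F]
        coherent_lower_expectation filter_bases_quantile_sets[OF ord F])
    also have "\<dots> \<le> (\<Sum>\<^sub>\<infinity>C\<in>?K. E (indicator C))"
      by (intro lower_expectation_event_le[OF ord F A coh agr] finite_sum_le_infsum[OF sum]
        coherent_event_nonneg[OF coh])
    finally show "E (indicator A) \<le> (\<Sum>\<^sub>\<infinity>C\<in>?K. E (indicator C))" .
    show "(\<Sum>\<^sub>\<infinity>C\<in>?K. E (indicator C)) \<le> E (indicator A)"
      by (rule infsum_le_finite_sums[OF sum partial])
  qed
qed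

theorem theorem13:
  fixes le :: "'a \<Rightarrow> 'a \<Rightarrow> bool" and lo hi :: 'a
    and Fl Fu :: "'a \<Rightarrow> real"
    and E :: "('a \<Rightarrow> real) \<Rightarrow> real"
    and B :: "'a set"
  assumes "bounded_total_preorder le lo hi"
    and "pbox le hi Fl Fu"
    and "natural_extension le lo hi Fl Fu E"
    and "clopen_in (partition_topology le) B"
  shows "(\<lambda>S. E (indicator S)) summable_on full_components le B \<and>
    E (indicator B) = (\<Sum>\<^sub>\<infinity>S\<in>full_components le B. E (indicator S)) \<and>
    (\<lambda>S. E (indicator S)) summable_on full_components le (- B) \<and>
    conjugate E (indicator B) = 1 - (\<Sum>\<^sub>\<infinity>S\<in>full_components le (- B). E (indicator S))"
proof -
  have B: "openin (partition_topology le) B" using assms(4) by (simp add: clopen_in_def)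
  have sym: "indiff le x y \<Longrightarrow> indiff le y x" for x y
    unfolding indiff_def by blast
  have "openin (partition_topology le) (- B)"
    using B sym unfolding openin_partition_topology_iff[OF assms(1)] by blast
  note compl = natural_extension_full_components[OF assms(1-3) this]
  have "coherent E" using assms(3) by (simp add: natural_extension_def)
  from conjugate_indicator[OF this, of B] show ?thesis
    using natural_extension_full_components[OF assms(1-3) B] compl by simp
qed

end
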